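(* Let $n\ge1$ and $N\ge2$ be integers. Then every nonnegative function in the class $\ell^{\frac{2N}{N-1},\infty}((\mathbb{Z}^n)^N)$ belongs to $\mathcal B_N((\mathbb{Z}^n)^N)$.
   Context: For a countable set $\mathbb K$ and $0<q<\infty$, $\ell^{q,\infty}(\mathbb K)$ is the set of complex sequences $a=\{a_k\}_{k\in\mathbb K}$ with $\|a\|_{\ell^{q,\infty}(\mathbb K)}=\sup_{t>0}\{t\,\sharp(\{k\in\mathbb K:|a_k|>t\})^{1/q}\}<\infty$, where $\sharp$ denotes cardinality. $\mathcal B_N((\mathbb{Z}^n)^N)$ is the set of nonnegative functions $V$ on $(\mathbb{Z}^n)^N$ for which there is $c\in(0,\infty)$ such that $$\sum_{\nu_1,\dots,\nu_N\in\mathbb{Z}^n}V(\nu_1,\dots,\nu_N)A_0(\nu_1+\dots+\nu_N)\prod_{j=1}^NA_j(\nu_j)\le c\prod_{j=0}^N\|A_j\|_{\ell^2(\mathbb{Z}^n)}$$ for all nonnegative functions $A_0,\dots,A_N$ on $\mathbb{Z}^n$. *)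

theory Defs
  imports "HOL-Analysis.Analysis"
begin

text \<open>
  All (quasi-)norms take values in \<open>[0, \<infinity>]\<close>, so that they are meaningful for arbitrary families.
  The lattice of the statement is \<^typ>\<open>int ^ 'n\<close>, with \<open>n = CARD('n)\<close>, and its \<open>N\<close>-fold power is
  \<^typ>\<open>(int ^ 'n) ^ 'm\<close>, with \<open>N = CARD('m)\<close>; the components of a point \<open>\<nu>\<close> of the latter are
  \<open>\<nu> $ j\<close> for \<open>j :: 'm\<close>.
\<close>

text \<open>
  The quantity \<open>t * card {k. \<bar>a k\<bar> > t} powr (1 / q)\<close> must be \<open>\<infinity>\<close> when the superlevel set is
  infinite, whereas \<^const>\<open>card\<close> is \<open>0\<close> there; hence the case distinction.
\<close>

definition weak_lq_norm :: "real \<Rightarrow> ('k::countable \<Rightarrow> complex) \<Rightarrow> ennreal" where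
  "weak_lq_norm q a =
     (SUP t\<in>{0<..}. if finite {k. cmod (a k) > t}
                    then ennreal (t * real (card {k. cmod (a k) > t}) powr (1 / q))
                    else \<infinity>)"

definition weak_lq :: "real \<Rightarrow> ('k::countable \<Rightarrow> complex) set" where
  "weak_lq q = {a. weak_lq_norm q a < \<infinity>}"

definition l2_norm :: "('k \<Rightarrow> real) \<Rightarrow> ennreal" where
  "l2_norm a = (if (\<lambda>k. (a k)\<^sup>2) summable_on UNIV
                then ennreal (sqrt (\<Sum>\<^sub>\<infinity>k. (a k)\<^sup>2)) else \<infinity>)"

text \<open>
  Both sides of the inequality are computed in \<open>[0, \<infinity>]\<close>, with \<open>0 * \<infinity> = 0\<close>. This convention
  is harmless: if one of the norms on the right vanishes, then so does the left-hand side.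
  The function \<open>A\<^sub>0\<close> is \<open>A0\<close>, and \<open>A\<^sub>1, \<dots>, A\<^sub>N\<close> are the members of \<open>A\<close>.
\<close>

definition class_B :: "((int ^ 'n::finite) ^ 'm::finite \<Rightarrow> real) set" where
  "class_B = {V. (\<forall>\<nu>. 0 \<le> V \<nu>) \<and>
     (\<exists>c::real. 0 < c \<and>
       (\<forall>(A0 :: int ^ 'n \<Rightarrow> real) (A :: 'm \<Rightarrow> int ^ 'n \<Rightarrow> real).
          (\<forall>\<mu>. 0 \<le> A0 \<mu>) \<longrightarrow> (\<forall>j \<mu>. 0 \<le> A j \<mu>) \<longrightarrow>
          (\<Sum>\<^sub>\<infinity>\<nu>. ennreal (V \<nu> * A0 (\<Sum>j\<in>UNIV. \<nu> $ j) * (\<Prod>j\<in>UNIV. A j (\<nu> $ j))))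
            \<le> ennreal c * (l2_norm A0 * (\<Prod>j\<in>UNIV. l2_norm (A j)))))}"

end

theory Submission
  imports Defs
begin

text \<open>
  Treat \<open>\<nu>\<^sub>0 = \<nu>\<^sub>1 + \<dots> + \<nu>\<^sub>N\<close> on the same footing as \<open>\<nu>\<^sub>1, \<dots>, \<nu>\<^sub>N\<close>, and put \<open>M = N + 1\<close>: any
  \<open>M - 1\<close> of these \<open>M\<close> coordinates determine \<open>\<nu>\<close>. The hypothesis on \<open>V\<close> enters only through
  \<open>\<Sum>\<^bsub>S\<^esub> V \<le> C * (card S) powr s\<close> for finite \<open>S\<close>, where \<open>s = M / (2 * (M - 1))\<close>.
  Cut each \<open>A\<^sub>i\<close>, normalised in \<open>\<ell>\<^sup>2\<close>, into dyadic level sets: let \<open>f\<^sub>i\<close> be the number of points where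
  \<open>A\<^sub>i\<close> has size \<open>2 powr m\<^sub>i\<close>, so that \<open>c\<^sub>i = 4 powr m\<^sub>i * f\<^sub>i\<close> has sum at most \<open>1\<close> over the levels \<open>m\<^sub>i\<close>.
  A block of level \<open>m\<close> contains at most \<open>\<Prod>\<^bsub>j \<noteq> a\<^esub> f\<^sub>j\<close> points, for every \<open>a\<close>. Taking \<open>a\<close> with \<open>m\<^sub>a\<close>
  minimal bounds its contribution by \<open>max c\<^sub>i\<close> times a factor decaying geometrically in
  \<open>\<Sum>\<^bsub>j\<^esub> (m\<^sub>j - m\<^sub>a)\<close>, which can be summed over all \<open>m\<close>.
\<close>

section \<open>From the weak-type bound to sums over finite sets\<close>

text \<open>Peel off a minimiser of \<open>V\<close>: if the minimum is positive, all n points of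
  \<open>S\<close> exceed half of it, so the weak-type bound makes it at most
  \<open>2 * K * n powr (s - 1)\<close>. Concavity dominates this by the increment of
  \<open>2 * K / s * n powr s\<close>, and the increments telescope.\<close>

lemma sum_weak_le:
  fixes V :: "'p \<Rightarrow> real"
  assumes V: "\<And>x. 0 \<le> V x" and s: "0 < s" "s < 1" and K: "0 \<le> K"
    and fin: "\<And>t. 0 < t \<Longrightarrow> finite {x. t < V x}"
    and le: "\<And>t. 0 < t \<Longrightarrow> t * real (card {x. t < V x}) powr (1 - s) \<le> K"
    and S: "finite S"
  shows "sum V S \<le> 2 * K / s * real (card S) powr s"
  using S
proof (induction "card S" arbitrary: S)
  case 0
  then show ?case by simp
next
  case (Suc k)
  define n where "n = real (Suc k)"
  have n: "n \<ge> 1" by (simp add: n_def)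
  have "S \<noteq> {}" using Suc.hyps(2) by auto
  then obtain x where x: "x \<in> S" and min: "\<And>y. y \<in> S \<Longrightarrow> V x \<le> V y"
    using Suc.prems arg_min_if_finite(1)[of S V] arg_min_least[of S _ V] by metis
  have Vx: "V x * n powr (1 - s) \<le> 2 * K"
  proof (cases "V x = 0")
    case False
    \<comment> \<open>Superlevel sets are strict, so the threshold has to lie below the minimum
      \<open>V x\<close>; halving costs the factor 2.\<close>
    with V[of x] have pos: "0 < V x / 2" by simp
    have "S \<subseteq> {y. V x / 2 < V y}"
      using min pos by force
    then have "n \<le> real (card {y. V x / 2 < V y})"
      using card_mono[OF fin[OF pos]] Suc.hyps(2) by (simp add: n_def)
    then have "V x / 2 * n powr (1 - s) \<le> V x / 2 * real (card {y. V x / 2 < V y}) powr (1 - s)"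
      using pos n s by (intro mult_left_mono powr_mono2) auto
    also have "\<dots> \<le> K" by (rule le[OF pos])
    finally show ?thesis by simp
  qed (use K in simp)
  have "V x = V x * n powr (1 - s) * n powr (s - 1)"
    using n by (simp add: powr_add[symmetric])
  also have "\<dots> \<le> 2 * K * n powr (s - 1)"
    using Vx by (intro mult_right_mono) auto
  finally have Vx': "V x \<le> 2 * K * n powr (s - 1)" .
  \<comment> \<open>weighted AM-GM in place of the concavity of the \<open>s\<close>-th power\<close>
  have concave: "(n - 1) powr s \<le> n powr s - s * n powr (s - 1)"
  proof (cases "n = 1")
    case True
    then show ?thesis using s by simp
  next
    case False
    with n have n1: "n > 1" by simp
    then have "((n - 1) / n) powr s * 1 powr (1 - s) \<le> s * ((n - 1) / n) + (1 - s) * 1"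
      using s by (intro Youngs_inequality_0) auto
    also have "\<dots> = 1 - s / n" using n1 by (simp add: field_simps)
    finally have "((n - 1) / n) powr s \<le> 1 - s / n" by simp
    then have "n powr s * ((n - 1) / n) powr s \<le> n powr s * (1 - s / n)"
      by (intro mult_left_mono) auto
    also have "n powr s * ((n - 1) / n) powr s = (n - 1) powr s"
      using n1 by (simp add: powr_divide)
    also have "n powr s * (1 - s / n) = n powr s - s * n powr (s - 1)"
      using n1 by (simp add: powr_diff right_diff_distrib)
    finally show ?thesis .
  qed
  have "card (S - {x}) = k" using Suc.hyps(2) Suc.prems x by simp
  then have "sum V (S - {x}) \<le> 2 * K / s * (n - 1) powr s"
    using Suc.hyps(1)[of "S - {x}"] Suc.prems by (simp add: n_def)
  also have "\<dots> \<le> 2 * K / s * (n powr s - s * n powr (s - 1))"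
    using concave K s by (intro mult_left_mono) auto
  also have "\<dots> = 2 * K / s * n powr s - 2 * K * n powr (s - 1)"
    using s by (simp add: field_simps)
  finally have "sum V S \<le> 2 * K / s * n powr s"
    using Vx' sum.remove[OF Suc.prems x, of V] by linarith
  then show ?case using Suc.hyps(2) by (simp add: n_def)
qed

section \<open>Geometric decay in the dyadic levels\<close>

text \<open>On either side of \<open>l\<close> the distance to \<open>l\<close> is injective, so
  each half is part of one geometric series. The bound depends neither on \<open>L\<close> nor on
  \<open>l\<close>, so levels can be summed one coordinate at a time.\<close>

lemma sum_int_geometric_le:
  fixes r :: real
  assumes r: "0 \<le> r" "r < 1" and L: "finite L"
  shows "(\<Sum>x\<in>L. r ^ nat \<bar>x - l\<bar>) \<le> 2 / (1 - r)"
proof -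
  have half: "(\<Sum>x\<in>A. r ^ nat \<bar>x - l\<bar>) \<le> 1 / (1 - r)"
    if "finite A" "inj_on (\<lambda>x. nat \<bar>x - l\<bar>) A" for A
  proof -
    have "(\<Sum>x\<in>A. r ^ nat \<bar>x - l\<bar>) = (\<Sum>n\<in>(\<lambda>x. nat \<bar>x - l\<bar>) ` A. r ^ n)"
      using that by (simp add: sum.reindex)
    also have "\<dots> \<le> (\<Sum>n. r ^ n)"
      using that r by (intro sum_le_suminf) auto
    also have "\<dots> = 1 / (1 - r)"
      using r by (simp add: suminf_geometric)
    finally show ?thesis .
  qed
  have "(\<Sum>x\<in>L. r ^ nat \<bar>x - l\<bar>)
      = (\<Sum>x\<in>L \<inter> {l..}. r ^ nat \<bar>x - l\<bar>) + (\<Sum>x\<in>L - {l..}. r ^ nat \<bar>x - l\<bar>)"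
    by (rule sum.Int_Diff[OF L])
  also have "\<dots> \<le> 1 / (1 - r) + 1 / (1 - r)"
    using L by (intro add_mono half) (auto simp: inj_on_def)
  finally show ?thesis by simp
qed

text \<open>Here \<open>F\<close> stands for the number of points of a block and \<open>f i\<close>
  for the size of its \<open>i\<close>-th level set. Two indices are at work: \<open>k\<close>
  maximises the weight \<open>4 powr m i * f i\<close>, while \<open>a\<close> minimises the level
  and selects which bound on \<open>F\<close> is used.\<close>

lemma dyadic_block_le:
  fixes m :: "'i::finite \<Rightarrow> int" and f :: "'i \<Rightarrow> real" and F :: real
  defines "M \<equiv> real CARD('i)"
  defines "r \<equiv> 2 powr (- 1 / (M * (M - 1)))"
  assumes M: "CARD('i) \<ge> 2"
    and f: "\<And>i. 0 \<le> f i" "\<And>i. 4 powr real_of_int (m i) * f i \<le> 1"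
    and F: "0 \<le> F" "\<And>a. F \<le> (\<Prod>j\<in>UNIV - {a}. f j)"
  shows "\<exists>k. (\<Prod>i\<in>UNIV. 2 powr real_of_int (m i)) * F powr (M / (2 * (M - 1)))
    \<le> 4 powr real_of_int (m k) * f k * (\<Prod>i\<in>UNIV. r ^ nat \<bar>m i - m k\<bar>)"
proof -
  define c where "c i = 4 powr real_of_int (m i) * f i" for i
  define s where "s = M / (2 * (M - 1))"
  define \<Sigma> where "\<Sigma> = (\<Sum>i\<in>UNIV. real_of_int (m i))"
  have M2: "M \<ge> 2" using M by (simp add: M_def)
  have s: "s > 0" using M2 by (simp add: s_def)
  have c: "0 \<le> c i" "c i \<le> 1" for i using f by (simp_all add: c_def)
  obtain k where k: "\<And>i. c i \<le> c k"
  proof -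
    have "Max (range c) \<in> range c" by (intro Max_in) auto
    then show ?thesis using that by (metis Max_ge finite finite_imageI imageE rangeI)
  qed
  obtain a where a: "\<And>i. m a \<le> m i"
  proof -
    have "Min (range m) \<in> range m" by (intro Min_in) auto
    then show ?thesis using that by (metis Min_le finite finite_imageI imageE rangeI)
  qed
  define D where "D = (\<Sum>i\<in>UNIV. real_of_int (m i - m a))"
  have D: "D = \<Sigma> - M * real_of_int (m a)"
    by (simp add: D_def \<Sigma>_def M_def sum_subtractf)
  have D_ge: "real_of_int (m i - m a) \<le> D" for i
    unfolding D_def by (rule member_le_sum) (use a in auto)
  have "F \<le> (\<Prod>j\<in>UNIV - {a}. f j)" by (rule F)
  also have "\<dots> \<le> (\<Prod>j\<in>UNIV - {a}. c k * 4 powr (- real_of_int (m j)))"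
  proof (intro prod_mono conjI f)
    fix j
    have "f j = c j * 4 powr (- real_of_int (m j))"
      by (simp add: c_def powr_minus)
    also have "\<dots> \<le> c k * 4 powr (- real_of_int (m j))"
      by (intro mult_right_mono k) auto
    finally show "f j \<le> c k * 4 powr (- real_of_int (m j))" .
  qed
  also have "\<dots> = c k ^ (CARD('i) - 1) * 4 powr (\<Sum>j\<in>UNIV - {a}. - real_of_int (m j))"
    by (simp add: prod.distrib powr_sum)
  also have "(\<Sum>j\<in>UNIV - {a}. - real_of_int (m j)) = real_of_int (m a) - \<Sigma>"
    by (simp add: \<Sigma>_def sum_negf sum.remove[of UNIV a])
  finally have F_le: "F \<le> c k ^ (CARD('i) - 1) * 4 powr (real_of_int (m a) - \<Sigma>)" .
  \<comment> \<open>The total exponent is \<open>(M - 1) * s = M / 2\<close>, at least 1, and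
    \<open>c k\<close> is at most 1. Only a first power of \<open>c k\<close> is kept, since that is
    what can be summed over the levels.\<close>
  have ck: "(c k ^ (CARD('i) - 1)) powr s \<le> c k"
  proof (cases "c k = 0")
    case True
    then show ?thesis using M by (simp add: power_0_left)
  next
    case False
    with c[of k] have pos: "0 < c k" by simp
    have "(c k ^ (CARD('i) - 1)) powr s = c k powr ((M - 1) * s)"
      using pos M by (simp add: powr_realpow[symmetric] powr_powr M_def of_nat_diff)
    also have "(M - 1) * s = M / 2" using M2 by (simp add: s_def field_simps)
    also have "c k powr (M / 2) \<le> c k powr 1"
      using pos c[of k] M2 by (intro powr_mono') auto
    finally show ?thesis using pos by simp
  qed
  have "F powr s \<le> (c k ^ (CARD('i) - 1) * 4 powr (real_of_int (m a) - \<Sigma>)) powr s"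
    using F_le F(1) s by (intro powr_mono2) auto
  also have "\<dots> = (c k ^ (CARD('i) - 1)) powr s * 4 powr ((real_of_int (m a) - \<Sigma>) * s)"
    using c by (simp add: powr_mult powr_powr)
  also have "\<dots> \<le> c k * 4 powr ((real_of_int (m a) - \<Sigma>) * s)"
    by (intro mult_right_mono ck) auto
  also have "(4::real) powr ((real_of_int (m a) - \<Sigma>) * s) = 2 powr (2 * ((real_of_int (m a) - \<Sigma>) * s))"
    using powr_powr[of 2 2 "(real_of_int (m a) - \<Sigma>) * s"] by simp
  finally have "2 powr \<Sigma> * F powr s \<le> 2 powr \<Sigma> * (c k * 2 powr (2 * ((real_of_int (m a) - \<Sigma>) * s)))"
    by (intro mult_left_mono) auto
  also have "\<dots> = c k * 2 powr (\<Sigma> + 2 * ((real_of_int (m a) - \<Sigma>) * s))"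
    by (simp add: powr_add)
  \<comment> \<open>Since \<open>2 * s = M / (M - 1)\<close>, the exponent depends on the levels
    only through their spread \<open>D\<close> above the lowest one.\<close>
  also have "\<Sigma> + 2 * ((real_of_int (m a) - \<Sigma>) * s) = - D / (M - 1)"
    using M2 by (simp add: D s_def field_simps)
  \<comment> \<open>Decay away from the lowest level is turned into decay away from
    \<open>m k\<close>, the level whose weight survives. Each of the \<open>M\<close> distances is
    at most \<open>D\<close>, whence the extra \<open>M\<close> in the exponent defining
    \<open>r\<close>.\<close>
  also have "c k * 2 powr (- D / (M - 1)) \<le> c k * (\<Prod>i\<in>UNIV. r ^ nat \<bar>m i - m k\<bar>)"
  proof (intro mult_left_mono c)
    have "real_of_int \<bar>m i - m k\<bar> \<le> D" for i
      using D_ge[of i] D_ge[of k] a[of i] a[of k] by linarith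
    then have "(\<Sum>i\<in>UNIV. real_of_int \<bar>m i - m k\<bar>) \<le> (\<Sum>i\<in>(UNIV::'i set). D)"
      by (intro sum_mono)
    then have sum_le: "(\<Sum>i\<in>UNIV. real_of_int \<bar>m i - m k\<bar>) \<le> M * D" by (simp add: M_def)
    have "- D / (M - 1) = - 1 / (M * (M - 1)) * (M * D)"
      using M2 by simp
    also have "\<dots> \<le> - 1 / (M * (M - 1)) * (\<Sum>i\<in>UNIV. real_of_int \<bar>m i - m k\<bar>)"
      using sum_le M2 by (intro mult_left_mono_neg) auto
    also have "\<dots> = (\<Sum>i\<in>UNIV. - 1 / (M * (M - 1)) * real_of_int \<bar>m i - m k\<bar>)"
      by (rule sum_distrib_left)
    finally have "2 powr (- D / (M - 1)) \<le> 2 powr (\<Sum>i\<in>UNIV. - 1 / (M * (M - 1)) * real_of_int \<bar>m i - m k\<bar>)"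
      by (intro powr_mono) auto
    also have "\<dots> = (\<Prod>i\<in>UNIV. 2 powr (- 1 / (M * (M - 1)) * real_of_int \<bar>m i - m k\<bar>))"
      by (simp add: powr_sum)
    also have "\<dots> = (\<Prod>i\<in>UNIV. r ^ nat \<bar>m i - m k\<bar>)"
      proof (intro prod.cong refl)
      fix i
      have "r ^ nat \<bar>m i - m k\<bar> = r powr real (nat \<bar>m i - m k\<bar>)"
        by (rule powr_realpow[symmetric]) (simp add: r_def)
      also have "real (nat \<bar>m i - m k\<bar>) = real_of_int \<bar>m i - m k\<bar>" by simp
      also have "r powr real_of_int \<bar>m i - m k\<bar> = 2 powr (- 1 / (M * (M - 1)) * real_of_int \<bar>m i - m k\<bar>)"
        unfolding r_def by (rule powr_powr)
      finally show "2 powr (- 1 / (M * (M - 1)) * real_of_int \<bar>m i - m k\<bar>) = r ^ nat \<bar>m i - m k\<bar>"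
        by (rule sym)
    qed
    finally show "2 powr (- D / (M - 1)) \<le> (\<Prod>i\<in>UNIV. r ^ nat \<bar>m i - m k\<bar>)" .
  qed
  finally have "2 powr \<Sigma> * F powr s \<le> c k * (\<Prod>i\<in>UNIV. r ^ nat \<bar>m i - m k\<bar>)" .
  moreover have "2 powr \<Sigma> = (\<Prod>i\<in>UNIV. 2 powr real_of_int (m i))"
    by (simp add: \<Sigma>_def powr_sum)
  ultimately show ?thesis by (auto simp: c_def s_def)
qed

section \<open>The multilinear estimate for finite sums\<close>

text \<open>Apply \<open>dyadic_block_le\<close> to each block of constant level and sum over the
  blocks. In the constant, \<open>2 ^ CARD('i)\<close> comes from rounding to powers of 2,
  \<open>M\<close> from the choice of \<open>k\<close> in each block, and the last power from the
  geometric sums.\<close>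

lemma multilinear_finite_le:
  fixes V :: "'p \<Rightarrow> real" and p :: "'i::finite \<Rightarrow> 'p \<Rightarrow> 'x"
  defines "M \<equiv> real CARD('i)"
  defines "r \<equiv> 2 powr (- 1 / (M * (M - 1)))"
  assumes M: "CARD('i) \<ge> 2"
    and det: "\<And>a \<nu> \<nu>'. (\<And>j. j \<noteq> a \<Longrightarrow> p j \<nu> = p j \<nu>') \<Longrightarrow> \<nu> = \<nu>'"
    and C: "0 \<le> C" and V: "\<And>\<nu>. 0 \<le> V \<nu>"
    and sum_V: "\<And>S. finite S \<Longrightarrow> sum V S \<le> C * real (card S) powr (M / (2 * (M - 1)))"
    and T: "finite T"
    and B: "\<And>i x. 0 \<le> B i x" "\<And>i X. finite X \<Longrightarrow> (\<Sum>x\<in>X. (B i x)\<^sup>2) \<le> 1"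
  shows "(\<Sum>\<nu>\<in>T. V \<nu> * (\<Prod>i\<in>UNIV. B i (p i \<nu>)))
    \<le> C * 2 ^ CARD('i) * (M * (2 / (1 - r)) ^ CARD('i))"
proof -
  define s where "s = M / (2 * (M - 1))"
  define lev where "lev i x = \<lfloor>log 2 (B i x)\<rfloor>" for i x
  \<comment> \<open>Points with a vanishing factor contribute nothing; without them every logarithm
    taken is of a positive number.\<close>
  define T' where "T' = {\<nu>\<in>T. \<forall>i. 0 < B i (p i \<nu>)}"
  define X where "X i = p i ` T'" for i
  define lv where "lv \<nu> = (\<lambda>i. lev i (p i \<nu>))" for \<nu>
  define L where "L = (\<Union>i. lev i ` X i)"
  define Fb where "Fb i l = {x\<in>X i. lev i x = l}" for i l
  define c where "c i l = 4 powr real_of_int l * real (card (Fb i l))" for i l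
  define G where "G = 2 / (1 - r)"
  have M2: "M \<ge> 2" using M by (simp add: M_def)
  have r: "0 \<le> r" "r < 1"
    using M2 by (auto simp: r_def powr_less_one)
  have finT': "finite T'" using T by (simp add: T'_def)
  have finX: "finite (X i)" for i using finT' by (simp add: X_def)
  have finF: "finite (Fb i l)" for i l using finX by (simp add: Fb_def)
  have finL: "finite L" using finX by (simp add: L_def)
  have finP: "finite (PiE (UNIV::'i set) (\<lambda>_. L))" using finL by (intro finite_PiE) auto
  have BX: "0 < B i x" if "x \<in> X i" for i x using that by (auto simp: X_def T'_def)
  have lo: "2 powr real_of_int (lev i x) \<le> B i x" if "x \<in> X i" for i x
  proof -
    have "2 powr real_of_int (lev i x) \<le> 2 powr (log 2 (B i x))"
      by (intro powr_mono) (auto simp: lev_def)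
    then show ?thesis using BX[OF that] by simp
  qed
  have hi: "B i x \<le> 2 * 2 powr real_of_int (lev i x)" if "x \<in> X i" for i x
  proof -
    have "2 powr (log 2 (B i x)) \<le> 2 powr (1 + real_of_int (lev i x))"
      unfolding lev_def by (intro powr_mono) linarith+
    then show ?thesis using BX[OF that] by (simp add: powr_add)
  qed
  \<comment> \<open>\<open>c i l\<close> is a lower bound for the part of the squared norm of
    \<open>B i\<close> carried by level \<open>l\<close>.\<close>
  have sum_c: "(\<Sum>l\<in>L. c i l) \<le> 1" for i
  proof -
    have "(\<Sum>l\<in>L. c i l) = (\<Sum>l\<in>L. \<Sum>x\<in>Fb i l. 4 powr real_of_int l)"
      by (simp add: c_def mult.commute)
    also have "\<dots> = (\<Sum>l\<in>L. \<Sum>x\<in>Fb i l. 4 powr real_of_int (lev i x))"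
      by (intro sum.cong) (auto simp: Fb_def)
    also have "\<dots> = (\<Sum>x\<in>X i. 4 powr real_of_int (lev i x))"
      unfolding Fb_def using finX finL by (intro sum.group) (auto simp: L_def)
    also have "\<dots> \<le> (\<Sum>x\<in>X i. (B i x)\<^sup>2)"
    proof (intro sum_mono)
      fix x assume x: "x \<in> X i"
      have "(4::real) powr real_of_int (lev i x) = (2 powr real_of_int (lev i x))\<^sup>2"
        by (simp add: power2_eq_square powr_mult[symmetric])
      also have "\<dots> \<le> (B i x)\<^sup>2" using lo[OF x] by (intro power_mono) auto
      finally show "4 powr real_of_int (lev i x) \<le> (B i x)\<^sup>2" .
    qed
    also have "\<dots> \<le> 1" by (rule B(2)[OF finX])
    finally show ?thesis .
  qed
  have c0: "0 \<le> c i l" for i l by (simp add: c_def)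
  have c1: "c i l \<le> 1" if "l \<in> L" for i l
    using member_le_sum[OF that, of "c i"] c0 finL sum_c[of i] by fastforce
  have lvL: "lv \<nu> \<in> PiE UNIV (\<lambda>_. L)" if "\<nu> \<in> T'" for \<nu>
    using that by (auto simp: lv_def L_def X_def)
  have block: "(\<Sum>\<nu>\<in>{\<nu>\<in>T'. lv \<nu> = m}. V \<nu> * (\<Prod>i\<in>UNIV. B i (p i \<nu>)))
      \<le> C * 2 ^ CARD('i) * (\<Sum>k\<in>UNIV. c k (m k) * (\<Prod>i\<in>UNIV. r ^ nat \<bar>m i - m k\<bar>))"
    if m: "m \<in> PiE UNIV (\<lambda>_. L)" for m
  proof -
    define S where "S = {\<nu>\<in>T'. lv \<nu> = m}"
    have finS: "finite S" using finT' by (simp add: S_def)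
    have mL: "m i \<in> L" for i using m by auto
    have card_S: "real (card S) \<le> (\<Prod>j\<in>UNIV - {a}. real (card (Fb j (m j))))" for a
    proof -
      define g where "g \<nu> = restrict (\<lambda>j. p j \<nu>) (UNIV - {a})" for \<nu>
      \<comment> \<open>By \<open>det\<close>, forgetting coordinate \<open>a\<close> loses no
        information, so the block embeds into a product of level sets.\<close>
      have "inj_on g S"
      proof (rule inj_onI)
        fix \<nu> \<nu>' assume "g \<nu> = g \<nu>'"
        then have "p j \<nu> = p j \<nu>'" if "j \<noteq> a" for j
          using that by (auto simp: g_def restrict_def fun_eq_iff split: if_splits)
        then show "\<nu> = \<nu>'" by (rule det)
      qed
      moreover have "g ` S \<subseteq> PiE (UNIV - {a}) (\<lambda>j. Fb j (m j))"
        by (auto simp: g_def S_def Fb_def X_def lv_def)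
      ultimately have "card S \<le> card (PiE (UNIV - {a}) (\<lambda>j. Fb j (m j)))"
        using finF by (intro card_inj_on_le) (auto intro!: finite_PiE)
      then have "card S \<le> (\<Prod>j\<in>UNIV - {a}. card (Fb j (m j)))"
        by (simp add: card_PiE)
      then show ?thesis by (metis of_nat_le_iff of_nat_prod)
    qed
    obtain k where k: "(\<Prod>i\<in>UNIV. 2 powr real_of_int (m i)) * real (card S) powr s
        \<le> c k (m k) * (\<Prod>i\<in>UNIV. r ^ nat \<bar>m i - m k\<bar>)"
      using dyadic_block_le[where m = m and f = "\<lambda>j. real (card (Fb j (m j)))" and F = "real (card S)"]
        M c1[OF mL] card_S
      unfolding c_def s_def r_def M_def by auto
    have "(\<Sum>\<nu>\<in>S. V \<nu> * (\<Prod>i\<in>UNIV. B i (p i \<nu>)))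
        \<le> (\<Sum>\<nu>\<in>S. V \<nu> * (\<Prod>i\<in>UNIV. 2 * 2 powr real_of_int (m i)))"
    proof (intro sum_mono mult_left_mono prod_mono conjI B V)
      fix \<nu> i assume "\<nu> \<in> S"
      then have "p i \<nu> \<in> X i" "lev i (p i \<nu>) = m i"
        by (auto simp: S_def X_def lv_def)
      then show "B i (p i \<nu>) \<le> 2 * 2 powr real_of_int (m i)" using hi by metis
    qed
    also have "\<dots> = 2 ^ CARD('i) * ((\<Prod>i\<in>UNIV. 2 powr real_of_int (m i)) * sum V S)"
      by (simp add: prod.distrib sum_distrib_right[symmetric])
    also have "\<dots> \<le> 2 ^ CARD('i) * ((\<Prod>i\<in>UNIV. 2 powr real_of_int (m i)) * (C * real (card S) powr s))"
      using sum_V[OF finS] by (intro mult_left_mono prod_nonneg) (auto simp: s_def)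
    also have "\<dots> = C * 2 ^ CARD('i) * ((\<Prod>i\<in>UNIV. 2 powr real_of_int (m i)) * real (card S) powr s)"
      by simp
    also have "\<dots> \<le> C * 2 ^ CARD('i) * (c k (m k) * (\<Prod>i\<in>UNIV. r ^ nat \<bar>m i - m k\<bar>))"
      using C by (intro mult_left_mono k) auto
    \<comment> \<open>The index \<open>k\<close> depends on \<open>m\<close>; summing over all
      indices removes this dependence, so that the sum over \<open>m\<close> can be taken for each
      fixed \<open>k\<close>.\<close>
    also have "\<dots> \<le> C * 2 ^ CARD('i) * (\<Sum>k\<in>UNIV. c k (m k) * (\<Prod>i\<in>UNIV. r ^ nat \<bar>m i - m k\<bar>))"
      using C c0 r by (intro mult_left_mono member_le_sum) (auto intro!: mult_nonneg_nonneg prod_nonneg)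
    finally show ?thesis by (simp add: S_def)
  qed
  have levels: "(\<Sum>m\<in>PiE UNIV (\<lambda>_. L). c k (m k) * (\<Prod>i\<in>UNIV. r ^ nat \<bar>m i - m k\<bar>)) \<le> G ^ CARD('i)"
    for k
  proof -
    let ?P = "PiE (UNIV::'i set) (\<lambda>_. L)"
    have G0: "0 \<le> G" using r by (simp add: G_def)
    have "(\<Sum>m\<in>?P. c k (m k) * (\<Prod>i\<in>UNIV. r ^ nat \<bar>m i - m k\<bar>))
        = (\<Sum>l\<in>L. \<Sum>m\<in>{m\<in>?P. m k = l}. c k (m k) * (\<Prod>i\<in>UNIV. r ^ nat \<bar>m i - m k\<bar>))"
      using finP finL by (intro sum.group[symmetric]) auto
    also have "\<dots> = (\<Sum>l\<in>L. \<Sum>m\<in>{m\<in>?P. m k = l}. c k l * (\<Prod>i\<in>UNIV. r ^ nat \<bar>m i - l\<bar>))"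
      by (intro sum.cong) auto
    \<comment> \<open>Lifting the constraint \<open>m k = l\<close> only adds nonnegative terms and
      makes the index set a full product, so the sum factors into one geometric sum per
      coordinate.\<close>
    also have "\<dots> \<le> (\<Sum>l\<in>L. \<Sum>m\<in>?P. c k l * (\<Prod>i\<in>UNIV. r ^ nat \<bar>m i - l\<bar>))"
      using finP c0 r by (intro sum_mono sum_mono2) (auto intro!: mult_nonneg_nonneg prod_nonneg)
    also have "\<dots> = (\<Sum>l\<in>L. c k l * (\<Prod>i\<in>(UNIV::'i set). \<Sum>x\<in>L. r ^ nat \<bar>x - l\<bar>))"
      by (simp only: prod_sum_PiE[OF finite finL] sum_distrib_left)
    also have "\<dots> \<le> (\<Sum>l\<in>L. c k l * (\<Prod>i\<in>(UNIV::'i set). G))"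
      using sum_int_geometric_le[OF r finL] r c0
      by (intro sum_mono mult_left_mono prod_mono) (auto simp: G_def intro!: sum_nonneg)
    also have "\<dots> = (\<Sum>l\<in>L. c k l) * G ^ CARD('i)"
      by (simp add: sum_distrib_right)
    also have "\<dots> \<le> 1 * G ^ CARD('i)"
      using G0 by (intro mult_right_mono sum_c) auto
    finally show ?thesis by simp
  qed
  have "(\<Sum>\<nu>\<in>T. V \<nu> * (\<Prod>i\<in>UNIV. B i (p i \<nu>))) = (\<Sum>\<nu>\<in>T'. V \<nu> * (\<Prod>i\<in>UNIV. B i (p i \<nu>)))"
  proof (rule sum.mono_neutral_right[OF T])
    show "\<forall>\<nu>\<in>T - T'. V \<nu> * (\<Prod>i\<in>UNIV. B i (p i \<nu>)) = 0"
      using B(1) by (force simp: T'_def less_le)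
  qed (auto simp: T'_def)
  also have "\<dots> = (\<Sum>m\<in>PiE UNIV (\<lambda>_. L). \<Sum>\<nu>\<in>{\<nu>\<in>T'. lv \<nu> = m}. V \<nu> * (\<Prod>i\<in>UNIV. B i (p i \<nu>)))"
    using finT' finP lvL by (intro sum.group[symmetric]) blast+
  also have "\<dots> \<le> (\<Sum>m\<in>PiE UNIV (\<lambda>_. L). C * 2 ^ CARD('i) * (\<Sum>k\<in>UNIV. c k (m k) * (\<Prod>i\<in>UNIV. r ^ nat \<bar>m i - m k\<bar>)))"
    by (intro sum_mono block)
  also have "\<dots> = C * 2 ^ CARD('i) * (\<Sum>k\<in>UNIV. \<Sum>m\<in>PiE UNIV (\<lambda>_. L). c k (m k) * (\<Prod>i\<in>UNIV. r ^ nat \<bar>m i - m k\<bar>))"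
    by (simp add: sum_distrib_left[symmetric] sum.swap[of _ "UNIV::'i set"])
  also have "\<dots> \<le> C * 2 ^ CARD('i) * (\<Sum>k\<in>(UNIV::'i set). G ^ CARD('i))"
    using C by (intro mult_left_mono sum_mono levels) auto
  finally show ?thesis by (simp add: G_def M_def)
qed

section \<open>From finite sums to sums with values in \<open>ennreal\<close>\<close>

lemma l2_norm_finiteE:
  assumes "l2_norm a < \<infinity>"
  obtains N where "0 \<le> N" "l2_norm a = ennreal N" "\<And>X. finite X \<Longrightarrow> (\<Sum>x\<in>X. (a x)\<^sup>2) \<le> N\<^sup>2"
proof -
  have summ: "(\<lambda>k. (a k)\<^sup>2) summable_on UNIV"
    using assms by (auto simp: l2_norm_def split: if_splits)
  have nn: "0 \<le> (\<Sum>\<^sub>\<infinity>k. (a k)\<^sup>2)" by (intro infsum_nonneg) auto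
  show ?thesis
  proof (rule that[of "sqrt (\<Sum>\<^sub>\<infinity>k. (a k)\<^sup>2)"])
    show "(\<Sum>x\<in>X. (a x)\<^sup>2) \<le> (sqrt (\<Sum>\<^sub>\<infinity>k. (a k)\<^sup>2))\<^sup>2" if "finite X" for X
      using that nn finite_sum_le_infsum[OF summ that] by simp
  qed (use summ nn in \<open>auto simp: l2_norm_def\<close>)
qed

text \<open>Nonvanishing matters because \<open>0 * \<infinity> = 0\<close> in
  \<open>ennreal\<close>.\<close>

lemma prod_ennreal_eq_top:
  fixes f :: "'a \<Rightarrow> ennreal"
  assumes "finite A" "\<And>x. x \<in> A \<Longrightarrow> f x \<noteq> 0" "x \<in> A" "f x = \<infinity>"
  shows "prod f A = \<infinity>"
  using assms by (subst prod.remove[of A x]) (auto simp: ennreal_top_mult)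

text \<open>By homogeneity, bounds for finite sums with normalised factors suffice; only zero and
  infinite norms escape the rescaling.\<close>

lemma multilinear_infsum_le:
  fixes V :: "'p \<Rightarrow> real" and p :: "'i::finite \<Rightarrow> 'p \<Rightarrow> 'x"
  assumes V: "\<And>\<nu>. 0 \<le> V \<nu>" and K: "0 < K"
    and bound: "\<And>T B. finite T \<Longrightarrow> (\<And>i x. 0 \<le> B i x) \<Longrightarrow>
      (\<And>i X. finite X \<Longrightarrow> (\<Sum>x\<in>X. (B i x)\<^sup>2) \<le> 1) \<Longrightarrow>
      (\<Sum>\<nu>\<in>T. V \<nu> * (\<Prod>i\<in>UNIV. B i (p i \<nu>))) \<le> K"
    and A: "\<And>i x. 0 \<le> A i x"
  shows "(\<Sum>\<^sub>\<infinity>\<nu>. ennreal (V \<nu> * (\<Prod>i\<in>UNIV. A i (p i \<nu>)))) \<le> ennreal K * (\<Prod>i\<in>UNIV. l2_norm (A i))"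
proof (rule infsum_le_finite_sums)
  fix T :: "'p set" assume T: "finite T"
  have nn: "0 \<le> V \<nu> * (\<Prod>i\<in>UNIV. A i (p i \<nu>))" for \<nu>
    using V A by (simp add: prod_nonneg)
  then have sum_eq: "(\<Sum>\<nu>\<in>T. ennreal (V \<nu> * (\<Prod>i\<in>UNIV. A i (p i \<nu>))))
      = ennreal (\<Sum>\<nu>\<in>T. V \<nu> * (\<Prod>i\<in>UNIV. A i (p i \<nu>)))"
    by (rule sum_ennreal)
  \<comment> \<open>A zero norm makes the right-hand side 0 even beside an infinite one, so the
    left-hand side must then vanish termwise. With zero norms excluded, an infinite norm makes the
    right-hand side infinite.\<close>
  consider (zero) i where "l2_norm (A i) = 0"
    | (top) i where "\<And>i. l2_norm (A i) \<noteq> 0" "l2_norm (A i) = \<infinity>"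
    | (fin) "\<And>i. l2_norm (A i) \<noteq> 0" "\<And>i. l2_norm (A i) < \<infinity>"
    by (metis infinity_ennreal_def less_top)
  then show "(\<Sum>\<nu>\<in>T. ennreal (V \<nu> * (\<Prod>i\<in>UNIV. A i (p i \<nu>)))) \<le> ennreal K * (\<Prod>i\<in>UNIV. l2_norm (A i))"
  proof cases
    case zero
    then obtain N where N: "l2_norm (A i) = ennreal N" "0 \<le> N"
        "\<And>X. finite X \<Longrightarrow> (\<Sum>x\<in>X. (A i x)\<^sup>2) \<le> N\<^sup>2"
      using l2_norm_finiteE[of "A i"] by auto
    with zero have "A i x = 0" for x
      using N(3)[of "{x}"] by simp
    then have "(\<Prod>i\<in>UNIV. A i (p i \<nu>)) = 0" for \<nu>
      by (meson UNIV_I finite prod_zero_iff)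
    then show ?thesis by (simp only: mult_zero_right ennreal_0 sum.neutral_const zero_le)
  next
    case top
    then have *: "(\<Prod>i\<in>UNIV. l2_norm (A i)) = \<infinity>"
      by (intro prod_ennreal_eq_top) auto
    then show ?thesis using K by (simp add: ennreal_mult_top)
  next
    case fin
    then have "\<forall>i. \<exists>N. 0 \<le> N \<and> l2_norm (A i) = ennreal N \<and> (\<forall>X. finite X \<longrightarrow> (\<Sum>x\<in>X. (A i x)\<^sup>2) \<le> N\<^sup>2)"
      by (metis l2_norm_finiteE)
    then obtain N where N: "\<And>i. 0 \<le> N i" "\<And>i. l2_norm (A i) = ennreal (N i)"
        "\<And>i X. finite X \<Longrightarrow> (\<Sum>x\<in>X. (A i x)\<^sup>2) \<le> (N i)\<^sup>2"
      by metis
    have Npos: "0 < N i" for i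
      using fin(1)[of i] N(1,2)[of i] by (auto simp: less_le)
    have scale: "(\<Prod>i\<in>UNIV. A i (p i \<nu>)) = (\<Prod>i\<in>UNIV. A i (p i \<nu>) / N i) * prod N UNIV" for \<nu>
      unfolding prod.distrib[symmetric] using Npos by (intro prod.cong) (auto simp: less_imp_neq[symmetric])
    have "(\<Sum>\<nu>\<in>T. V \<nu> * (\<Prod>i\<in>UNIV. A i (p i \<nu>) / N i)) \<le> K"
    proof (rule bound[OF T, where B = "\<lambda>i x. A i x / N i"])
      show "(\<Sum>x\<in>X. (A i x / N i)\<^sup>2) \<le> 1" if "finite X" for i X
        using N(3)[OF that] Npos[of i] by (simp add: power_divide sum_divide_distrib[symmetric])
    qed (use A N in auto)
    then have "(\<Sum>\<nu>\<in>T. V \<nu> * (\<Prod>i\<in>UNIV. A i (p i \<nu>) / N i)) * prod N UNIV \<le> K * prod N UNIV"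
      using N(1) by (intro mult_right_mono prod_nonneg) auto
    also have "(\<Sum>\<nu>\<in>T. V \<nu> * (\<Prod>i\<in>UNIV. A i (p i \<nu>) / N i)) * prod N UNIV
        = (\<Sum>\<nu>\<in>T. V \<nu> * (\<Prod>i\<in>UNIV. A i (p i \<nu>)))"
      by (subst scale) (simp add: sum_distrib_right mult.assoc)
    finally show ?thesis
      unfolding sum_eq using K N(1) by (simp add: N(2) prod_ennreal ennreal_mult[symmetric] prod_nonneg)
  qed
qed (simp add: nonneg_summable_on_complete)

section \<open>The sum of the components as one more coordinate\<close>

theorem proposition3p3:
  fixes V :: "(int ^ 'n::finite) ^ 'm::finite \<Rightarrow> real"
  assumes "CARD('m) \<ge> 2"
    and "\<And>\<nu>. 0 \<le> V \<nu>"
    and "(\<lambda>\<nu>. complex_of_real (V \<nu>)) \<in> weak_lq (2 * real CARD('m) / (real CARD('m) - 1))"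
  shows "V \<in> class_B"
proof -
  define N where "N = real CARD('m)"
  \<comment> \<open>This is \<open>M / (2 * (M - 1))\<close> for \<open>M = N + 1\<close>; with q
    the weak exponent, 1 / q equals \<open>1 - s\<close>.\<close>
  define s where "s = (N + 1) / (2 * N)"
  define W where "W = weak_lq_norm (2 * N / (N - 1)) (\<lambda>\<nu>. complex_of_real (V \<nu>))"
  define K where "K = enn2real W"
  have N: "N \<ge> 2" using assms(1) by (simp add: N_def)
  have s: "0 < s" "s < 1" and s': "1 / (2 * N / (N - 1)) = 1 - s"
    using N by (auto simp: s_def field_simps)
  have W: "W = ennreal K" "W < \<infinity>"
    using assms(3) by (auto simp: weak_lq_def K_def W_def N_def)
  have K: "0 \<le> K" by (simp add: K_def)
  have superlevel: "finite {\<nu>. t < V \<nu>} \<and> t * real (card {\<nu>. t < V \<nu>}) powr (1 - s) \<le> K"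
    if t: "0 < t" for t
  proof -
    \<comment> \<open>The term at \<open>t\<close> is at most the supremum \<open>W\<close>;
      finiteness of \<open>W\<close> excludes the infinite branch and so yields finiteness of the
      superlevel set.\<close>
    have "(if finite {\<nu>. t < V \<nu>} then ennreal (t * real (card {\<nu>. t < V \<nu>}) powr (1 - s)) else \<infinity>) \<le> W"
      unfolding W_def weak_lq_norm_def s'
      by (rule SUP_upper2[of t]) (use t assms(2) in auto)
    then show ?thesis using W K by (auto split: if_splits simp: top_unique)
  qed
  \<comment> \<open>\<open>None\<close> indexes the argument of \<open>A0\<close> and
    \<open>Some j\<close> that of \<open>A j\<close>, so \<open>'m option\<close> has
    \<open>N + 1\<close> elements.\<close>
  define p :: "'m option \<Rightarrow> (int ^ 'n) ^ 'm \<Rightarrow> int ^ 'n"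
    where "p i \<nu> = (case i of None \<Rightarrow> \<Sum>j\<in>UNIV. \<nu> $ j | Some j \<Rightarrow> \<nu> $ j)" for i \<nu>
  have det: "\<nu> = \<nu>'" if eq: "\<And>j. j \<noteq> a \<Longrightarrow> p j \<nu> = p j \<nu>'" for a \<nu> \<nu>'
  proof (cases a)
    case None
    then show ?thesis using eq[of "Some _"] by (simp add: p_def vec_eq_iff)
  next
    case (Some k)
    have other: "\<nu> $ j = \<nu>' $ j" if "j \<noteq> k" for j
      using eq[of "Some j"] that Some by (simp add: p_def)
    \<comment> \<open>The missing component is recovered as the total minus the other
      components.\<close>
    have "(\<Sum>j\<in>UNIV. \<nu> $ j) = (\<Sum>j\<in>UNIV. \<nu>' $ j)"
      using eq[of None] Some by (simp add: p_def)
    moreover have "(\<Sum>j\<in>UNIV - {k}. \<nu> $ j) = (\<Sum>j\<in>UNIV - {k}. \<nu>' $ j)"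
      using other by (intro sum.cong) auto
    ultimately have "\<nu> $ k = \<nu>' $ k"
      by (simp add: sum.remove[of UNIV k])
    with other show ?thesis by (metis vec_eq_iff)
  qed
  have cardM: "real CARD('m option) = N + 1" "CARD('m option) \<ge> 2"
    using assms(1) by (simp_all add: N_def)
  define C where "C = 2 * K / s"
  have C: "0 \<le> C" using K s by (simp add: C_def)
  have sum_V: "sum V S \<le> C * real (card S) powr (real CARD('m option) / (2 * (real CARD('m option) - 1)))"
    if "finite S" for S
  proof -
    have "sum V S \<le> C * real (card S) powr s"
      unfolding C_def
      proof (rule sum_weak_le[OF assms(2) s K _ _ that])
        show "finite {x. t < V x}" "t * real (card {x. t < V x}) powr (1 - s) \<le> K" if "0 < t" for t
          using superlevel[OF that] by auto
      qed
    then show ?thesis by (simp only: cardM s_def add_diff_cancel_right')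
  qed
  obtain K' where K': "\<And>T B. finite T \<Longrightarrow> (\<And>i x. 0 \<le> B i x) \<Longrightarrow>
      (\<And>i X. finite X \<Longrightarrow> (\<Sum>x\<in>X. (B i x)\<^sup>2) \<le> 1) \<Longrightarrow>
      (\<Sum>\<nu>\<in>T. V \<nu> * (\<Prod>i\<in>UNIV. B i (p i \<nu>))) \<le> K'"
    proof (rule that)
    fix T :: "((int ^ 'n) ^ 'm) set" and B :: "'m option \<Rightarrow> int ^ 'n \<Rightarrow> real"
    assume "finite T" "\<And>i x. 0 \<le> B i x" "\<And>i X. finite X \<Longrightarrow> (\<Sum>x\<in>X. (B i x)\<^sup>2) \<le> 1"
    note B = this
    show "(\<Sum>\<nu>\<in>T. V \<nu> * (\<Prod>i\<in>UNIV. B i (p i \<nu>)))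
        \<le> C * 2 ^ CARD('m option) * (real CARD('m option) * (2 / (1 - 2 powr (- 1 /
            (real CARD('m option) * (real CARD('m option) - 1))))) ^ CARD('m option))"
      by (rule multilinear_finite_le) (fact cardM(2) det C assms(2) sum_V B)+
  qed
  \<comment> \<open>\<open>class_B\<close> asks for a strictly positive constant, whereas the bound
    found here vanishes when \<open>K = 0\<close>.\<close>
  define c where "c = max K' 1"
  have prod_option: "(\<Prod>i\<in>UNIV. f i) = f None * (\<Prod>j\<in>UNIV. f (Some j))"
    for f :: "'m option \<Rightarrow> 'c::comm_monoid_mult"
    by (simp add: UNIV_option_conv prod.reindex)
  show ?thesis
    unfolding class_B_def
  proof (intro CollectI conjI exI[of _ c] allI impI assms(2))
    show "0 < c" by (simp add: c_def)
    fix A0 :: "int ^ 'n \<Rightarrow> real" and A :: "'m \<Rightarrow> int ^ 'n \<Rightarrow> real"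
    assume A: "\<forall>\<mu>. 0 \<le> A0 \<mu>" "\<forall>j \<mu>. 0 \<le> A j \<mu>"
    have "(\<Sum>\<^sub>\<infinity>\<nu>. ennreal (V \<nu> * (\<Prod>i\<in>UNIV. case_option A0 A i (p i \<nu>))))
        \<le> ennreal c * (\<Prod>i\<in>UNIV. l2_norm (case_option A0 A i))"
    proof (rule multilinear_infsum_le)
      show "(\<Sum>\<nu>\<in>T. V \<nu> * (\<Prod>i\<in>UNIV. B i (p i \<nu>))) \<le> c"
        if "finite T" "\<And>i x. 0 \<le> B i x" "\<And>i X. finite X \<Longrightarrow> (\<Sum>x\<in>X. (B i x)\<^sup>2) \<le> 1" for T B
        using K'[of T B, OF that] by (simp add: c_def)
    qed (use A assms(2) in \<open>auto simp: c_def split: option.split\<close>)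
    then show "(\<Sum>\<^sub>\<infinity>\<nu>. ennreal (V \<nu> * A0 (\<Sum>j\<in>UNIV. \<nu> $ j) * (\<Prod>j\<in>UNIV. A j (\<nu> $ j))))
        \<le> ennreal c * (l2_norm A0 * (\<Prod>j\<in>UNIV. l2_norm (A j)))"
      by (simp add: prod_option p_def mult.assoc)
  qed
qed

end
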